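(* Let $H$ be a homogeneous relation on a finite set $X$ and let $\mathcal Z(H)=\{Z(x,y)\mid x,y\in X,\ x\neq y\}$. Then every support and every atom of an overlap class of $\mathcal Z(H)$ that is a homogeneous module of $H$ is a strong homogeneous module of $H$. Moreover, every non-trivial strong homogeneous module of $H$ is either the support or an atom of some overlap class of $\mathcal Z(H)$.
   Context: A diverse triple of $X$ is $(x,y,z)\in X^3$ with $x\neq y$, $x\neq z$, written $(x|yz)$. A homogeneous relation $H$ on $X$ is a relation on diverse triples such that for every $x\in X$ the relation $H_x(y,z)\Leftrightarrow H(x|yz)$ is an equivalence relation on $X\setminus\{x\}$. $M\subseteq X$ is a homogeneous module if $H(x|mm')$ for all $m,m'\in M$, $x\in X\setminus M$; it is trivial if $|M|\le 1$ or $M=X$. Sets $A,B$ overlap if $A\cap B$, $A\setminus B$, $B\setminus A$ are all non-empty. A homogeneous module is strong if it overlaps no other homogeneous module. For distinct $x,y\in X$, $Z(x,y)$ is the largest homogeneous module of $H$ containing $x$ but not $y$ (the union of all such modules, which is itself a homogeneous module). An overlap class of a family $\mathcal F$ is an equivalence class of the transitive closure of the overlap relation on $\mathcal F$; its support is the union of its members; an atom of an overlap class $\mathcal C$ is a maximal subset of its support that overlaps no member of $\mathcal C$.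
   Formalization: An atom is here a maximal subset of the support that overlaps no member of the class and is also contained in some member; without this proviso the support itself would be the only atom and the second claim would fail. *)

theory Defs
  imports Main
begin

text \<open>A relation on diverse triples is a set of triples; \<open>(x, y, z) \<in> H\<close> stands for \<open>H(x|yz)\<close>.\<close>

definition diverse_triples :: "'a set \<Rightarrow> ('a \<times> 'a \<times> 'a) set" where
  "diverse_triples X = {(x, y, z). x \<in> X \<and> y \<in> X \<and> z \<in> X \<and> x \<noteq> y \<and> x \<noteq> z}"

definition homogeneous_relation :: "'a set \<Rightarrow> ('a \<times> 'a \<times> 'a) set \<Rightarrow> bool" where
  "homogeneous_relation X H \<longleftrightarrow>
     H \<subseteq> diverse_triples X \<and> (\<forall>x\<in>X. equiv (X - {x}) {(y, z). (x, y, z) \<in> H})"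

definition homogeneous_module :: "'a set \<Rightarrow> ('a \<times> 'a \<times> 'a) set \<Rightarrow> 'a set \<Rightarrow> bool" where
  "homogeneous_module X H M \<longleftrightarrow>
     M \<subseteq> X \<and> (\<forall>x\<in>X - M. \<forall>m\<in>M. \<forall>m'\<in>M. (x, m, m') \<in> H)"

definition trivial_module :: "'a set \<Rightarrow> 'a set \<Rightarrow> bool" where
  "trivial_module X M \<longleftrightarrow> card M \<le> 1 \<or> M = X"

definition overlaps :: "'a set \<Rightarrow> 'a set \<Rightarrow> bool" where
  "overlaps A B \<longleftrightarrow> A \<inter> B \<noteq> {} \<and> A - B \<noteq> {} \<and> B - A \<noteq> {}"

definition strong_module :: "'a set \<Rightarrow> ('a \<times> 'a \<times> 'a) set \<Rightarrow> 'a set \<Rightarrow> bool" where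
  "strong_module X H M \<longleftrightarrow>
     homogeneous_module X H M \<and> (\<forall>N. homogeneous_module X H N \<longrightarrow> \<not> overlaps M N)"

definition Z :: "'a set \<Rightarrow> ('a \<times> 'a \<times> 'a) set \<Rightarrow> 'a \<Rightarrow> 'a \<Rightarrow> 'a set" where
  "Z X H x y = \<Union>{M. homogeneous_module X H M \<and> x \<in> M \<and> y \<notin> M}"

definition Z_family :: "'a set \<Rightarrow> ('a \<times> 'a \<times> 'a) set \<Rightarrow> 'a set set" where
  "Z_family X H = {Z X H x y | x y. x \<in> X \<and> y \<in> X \<and> x \<noteq> y}"

text \<open>
  Overlapping is symmetric but irreflexive. The closure is taken reflexively, so that it is an
  equivalence relation on the family: a member that overlaps no other member forms an overlap
  class on its own.
\<close>

definition overlap_classes :: "'a set set \<Rightarrow> 'a set set set" where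
  "overlap_classes F = F // {(A, B). A \<in> F \<and> B \<in> F \<and> overlaps A B}\<^sup>*"

definition support :: "'a set set \<Rightarrow> 'a set" where
  "support C = \<Union>C"

text \<open>
  The support of a class itself never overlaps a member of the class, so maximality has to be
  understood among the subsets of the support that lie inside some member; otherwise the support
  would be the only atom. With this proviso the atoms of an overlap class are the blocks of the
  partition of its support that is induced by membership in the sets of the class
  (\<open>atom_iff\<close> below).
\<close>

definition unsplit :: "'a set set \<Rightarrow> 'a set \<Rightarrow> bool" where
  "unsplit C T \<longleftrightarrow> T \<subseteq> support C \<and> (\<exists>A\<in>C. T \<subseteq> A) \<and> (\<forall>A\<in>C. \<not> overlaps T A)"

definition atom :: "'a set set \<Rightarrow> 'a set \<Rightarrow> bool" where
  "atom C T \<longleftrightarrow> unsplit C T \<and> (\<forall>T'. unsplit C T' \<and> T \<subseteq> T' \<longrightarrow> T' = T)"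

lemma Z_homogeneous_module:
  assumes "homogeneous_relation X H"
  shows "homogeneous_module X H (Z X H x y)"
  unfolding homogeneous_module_def
proof (intro conjI ballI)
  show "Z X H x y \<subseteq> X" by (auto simp: Z_def homogeneous_module_def)
next
  fix w m m' assume w: "w \<in> X - Z X H x y" and m: "m \<in> Z X H x y" and m': "m' \<in> Z X H x y"
  from m obtain M where M: "homogeneous_module X H M" "x \<in> M" "y \<notin> M" "m \<in> M"
    by (auto simp: Z_def)
  from m' obtain N where N: "homogeneous_module X H N" "x \<in> N" "y \<notin> N" "m' \<in> N"
    by (auto simp: Z_def)
  from w M N have "w \<notin> M" "w \<notin> N" by (auto simp: Z_def)
  with w M N have "(w, m, x) \<in> H" "(w, x, m') \<in> H" by (auto simp: homogeneous_module_def)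
  moreover have "trans {(y, z). (w, y, z) \<in> H}"
    using assms w by (auto simp: homogeneous_relation_def equiv_def)
  ultimately show "(w, m, m') \<in> H" by (auto dest: transD)
qed

lemma support_not_overlaps: "A \<in> C \<Longrightarrow> \<not> overlaps (support C) A"
  by (auto simp: overlaps_def support_def)

lemma unsplit_same_members:
  assumes C: "C \<in> overlap_classes F" and T: "unsplit C T"
    and xy: "x \<in> T" "y \<in> T" and A: "A \<in> C" "x \<in> A"
  shows "y \<in> A"
proof (rule ccontr)
  assume y: "y \<notin> A"
  let ?r = "{(A, B). A \<in> F \<and> B \<in> F \<and> overlaps A B}"
  have sym: "sym (?r\<^sup>*)" by (rule sym_rtrancl) (auto simp: sym_def overlaps_def)
  obtain A0 where A0: "C = ?r\<^sup>* `` {A0}" "A0 \<in> F"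
    using C unfolding overlap_classes_def by (rule quotientE)
  have conn: "(D, E) \<in> ?r\<^sup>*" if "D \<in> C" "E \<in> C" for D E
  proof -
    from that A0 have "(A0, D) \<in> ?r\<^sup>*" "(A0, E) \<in> ?r\<^sup>*" by auto
    then show ?thesis using sym by (blast intro: rtrancl_trans dest: symD)
  qed
  have AT: "A \<subseteq> T" using T xy A y by (auto simp: unsplit_def overlaps_def)
  obtain B where B: "B \<in> C" "T \<subseteq> B" using T by (auto simp: unsplit_def)
  have sub: "D \<subseteq> T \<and> D \<in> C" if "(A, D) \<in> ?r\<^sup>*" for D
    using that
  proof induction
    case base then show ?case using AT A by simp
  next
    case (step D E)
    have "E \<in> C" using step A0 by (auto intro: rtrancl_into_rtrancl)
    with T have "\<not> overlaps T E" by (simp add: unsplit_def)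
    with step show ?case using \<open>E \<in> C\<close> by (auto simp: overlaps_def)
  qed
  have TB: "T = B" using sub[OF conn[OF A(1) B(1)]] B by auto
  from conn[OF B(1) A(1)] show False
  proof (cases rule: converse_rtranclE)
    case base then show False using TB xy y by simp
  next
    case (step E)
    then have "E \<in> C" using B A0 by (auto intro: rtrancl_into_rtrancl)
    then have "E \<subseteq> B" using sub conn[OF A(1)] TB by blast
    with step show False by (auto simp: overlaps_def)
  qed
qed

lemma atom_iff:
  assumes C: "C \<in> overlap_classes F" and ne: "{} \<notin> F"
  shows "atom C T \<longleftrightarrow> (\<exists>x\<in>support C. T = {y \<in> support C. \<forall>A\<in>C. x \<in> A \<longleftrightarrow> y \<in> A})"
proof -
  define blk where "blk x = {y \<in> support C. \<forall>A\<in>C. x \<in> A \<longleftrightarrow> y \<in> A}" for x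
  let ?r = "{(A, B). A \<in> F \<and> B \<in> F \<and> overlaps A B}"
  obtain A0 where A0: "C = ?r\<^sup>* `` {A0}" "A0 \<in> F"
    using C unfolding overlap_classes_def by (rule quotientE)
  then have "A0 \<in> C" by simp
  moreover have "A0 \<noteq> {}" using A0(2) ne by metis
  ultimately obtain x0 where x0: "x0 \<in> support C" unfolding support_def by blast
  have mem: "y \<in> A" if "y \<in> blk x" "A \<in> C" "x \<in> A" for x y A
    using that unfolding blk_def by blast
  have mem': "x \<in> A" if "y \<in> blk x" "A \<in> C" "y \<in> A" for x y A
    using that unfolding blk_def by blast
  have blk: "unsplit C (blk x)" "x \<in> blk x" if x: "x \<in> support C" for x
  proof -
    obtain A where A: "A \<in> C" "x \<in> A" using x unfolding support_def by blast
    then have "blk x \<subseteq> A" using mem by blast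
    moreover have "blk x \<subseteq> support C" unfolding blk_def by blast
    moreover have "\<not> overlaps (blk x) B" if "B \<in> C" for B
      using mem[OF _ that] mem'[OF _ that] unfolding overlaps_def by blast
    ultimately show "unsplit C (blk x)" using A(1) unfolding unsplit_def by blast
    show "x \<in> blk x" using x unfolding blk_def by blast
  qed
  have le: "T \<subseteq> blk x" if u: "unsplit C T" and x: "x \<in> T" for T x
  proof
    fix y assume y: "y \<in> T"
    with u have "y \<in> support C" unfolding unsplit_def by blast
    then show "y \<in> blk x"
      using unsplit_same_members[OF C u x y] unsplit_same_members[OF C u y x]
      unfolding blk_def by blast
  qed
  have "atom C T \<longleftrightarrow> (\<exists>x\<in>support C. T = blk x)"
  proof
    assume T: "atom C T"
    then have u: "unsplit C T" by (simp add: atom_def)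
    have "T \<noteq> {}" using T blk[OF x0] unfolding atom_def by blast
    then obtain x where x: "x \<in> T" by blast
    with u have xs: "x \<in> support C" unfolding unsplit_def by blast
    have "blk x = T" using T le[OF u x] blk(1)[OF xs] unfolding atom_def by blast
    with xs show "\<exists>x\<in>support C. T = blk x" by blast
  next
    assume "\<exists>x\<in>support C. T = blk x"
    then obtain x where x: "x \<in> support C" "T = blk x" by blast
    have "T' = T" if "unsplit C T'" "T \<subseteq> T'" for T'
      using le[OF that(1), of x] that(2) blk(2)[OF x(1)] x(2) by blast
    then show "atom C T" using blk(1)[OF x(1)] x(2) by (simp add: atom_def)
  qed
  then show ?thesis by (simp add: blk_def)
qed

end

theory Submission
  imports Defs
begin

text \<open>
  Everything rests on one observation: if a module \<open>N\<close> contains \<open>x\<close> but not \<open>y\<close>, then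
  \<open>N \<subseteq> Z(x, y)\<close>. So if \<open>N\<close> overlapped a support or an atom, with \<open>x\<close> in the intersection and \<open>y\<close>
  outside \<open>N\<close>, then \<open>Z(x, y)\<close> would overlap a member of the class and hence belong to it, which
  contradicts the choice of the support or of the atom. Conversely, a strong module \<open>M\<close> that
  is itself some \<open>Z(x, y)\<close> overlaps no other module and forms a class of its own. Any other \<open>M\<close> lies in a
  minimal \<open>P = Z(a, b)\<close>, and then \<open>Z(m, p)\<close> overlaps \<open>P\<close> for all \<open>m \<in> M\<close>, \<open>p \<in> P - M\<close>; so these
  sets belong to the class of \<open>P\<close> and together cut out \<open>M\<close> as an atom.
\<close>

section \<open>Overlap classes of a family\<close>

lemma overlap_class_subset: "C \<in> overlap_classes F \<Longrightarrow> C \<subseteq> F"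
proof
  fix B assume C: "C \<in> overlap_classes F" and B: "B \<in> C"
  obtain A where "A \<in> F" "(A, B) \<in> {(A, B). A \<in> F \<and> B \<in> F \<and> overlaps A B}\<^sup>*"
    using C B unfolding overlap_classes_def by (auto elim!: quotientE)
  from this(2,1) show "B \<in> F" by (cases rule: rtranclE) auto
qed

lemma in_overlap_class:
  assumes "A \<in> F"
  obtains C where "C \<in> overlap_classes F" "A \<in> C"
proof
  let ?r = "{(A, B). A \<in> F \<and> B \<in> F \<and> overlaps A B}"
  show "?r\<^sup>* `` {A} \<in> overlap_classes F"
    unfolding overlap_classes_def using assms by (rule quotientI)
  show "A \<in> ?r\<^sup>* `` {A}" by simp
qed

lemma overlap_class_closed:
  assumes C: "C \<in> overlap_classes F" and A: "A \<in> C" and B: "B \<in> F" and AB: "overlaps A B"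
  shows "B \<in> C"
proof -
  let ?r = "{(A, B). A \<in> F \<and> B \<in> F \<and> overlaps A B}"
  obtain A0 where A0: "C = ?r\<^sup>* `` {A0}"
    using C unfolding overlap_classes_def by (rule quotientE)
  have "(A, B) \<in> ?r" using overlap_class_subset[OF C] A B AB by blast
  moreover have "(A0, A) \<in> ?r\<^sup>*" using A A0 by simp
  ultimately have "(A0, B) \<in> ?r\<^sup>*" by (rule rtrancl_into_rtrancl[rotated])
  then show ?thesis using A0 by simp
qed

text \<open>Properties spread along chains of overlaps. Any member can serve as the start, because
  overlapping, and hence its closure, is symmetric.\<close>

lemma overlap_class_induct [consumes 3, case_names base step]:
  assumes C: "C \<in> overlap_classes F" and A: "A \<in> C" and B: "B \<in> C"
    and base: "P A"
    and step: "\<And>D E. D \<in> C \<Longrightarrow> E \<in> C \<Longrightarrow> overlaps D E \<Longrightarrow> P D \<Longrightarrow> P E"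
  shows "P B"
proof -
  let ?r = "{(A, B). A \<in> F \<and> B \<in> F \<and> overlaps A B}"
  obtain A0 where A0: "C = ?r\<^sup>* `` {A0}"
    using C unfolding overlap_classes_def by (rule quotientE)
  have "sym (?r\<^sup>*)"
    by (rule sym_rtrancl) (auto simp: sym_def overlaps_def)
  moreover have "(A0, A) \<in> ?r\<^sup>*" "(A0, B) \<in> ?r\<^sup>*"
    using A B A0 by auto
  ultimately have "(A, B) \<in> ?r\<^sup>*"
    by (blast intro: rtrancl_trans dest: symD)
  then have "B \<in> C \<and> P B"
  proof induction
    case base
    show ?case using A assms(4) by blast
  next
    case (step D E)
    then have "E \<in> C" using overlap_class_closed[OF C] by blast
    with step assms(5) show ?case by blast
  qed
  then show ?thesis ..
qed

section \<open>The modules Z(x, y)\<close>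

lemma module_subset_Z: "homogeneous_module X H N \<Longrightarrow> x \<in> N \<Longrightarrow> y \<notin> N \<Longrightarrow> N \<subseteq> Z X H x y"
  by (auto simp: Z_def)

lemma not_in_Z: "y \<notin> Z X H x y"
  by (auto simp: Z_def)

lemma Z_in_Z_family: "x \<in> X \<Longrightarrow> y \<in> X \<Longrightarrow> x \<noteq> y \<Longrightarrow> Z X H x y \<in> Z_family X H"
  by (auto simp: Z_family_def)

lemma Z_family_module:
  "homogeneous_relation X H \<Longrightarrow> A \<in> Z_family X H \<Longrightarrow> homogeneous_module X H A"
  by (auto simp: Z_family_def Z_homogeneous_module)

lemma module_subset: "homogeneous_module X H M \<Longrightarrow> M \<subseteq> X"
  by (simp add: homogeneous_module_def)

section \<open>Supports\<close>

text \<open>A point \<open>w\<close> outside the support does not distinguish two elements of one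
  member. Consecutive members of a chain share an element, so transitivity of the relation at
  \<open>w\<close> carries this along the chain.\<close>

lemma support_homogeneous_module:
  assumes H: "homogeneous_relation X H" and C: "C \<in> overlap_classes F"
    and F: "\<And>A. A \<in> F \<Longrightarrow> homogeneous_module X H A"
  shows "homogeneous_module X H (support C)"
  unfolding homogeneous_module_def
proof (intro conjI ballI)
  have mod: "homogeneous_module X H A" if "A \<in> C" for A
    using that F overlap_class_subset[OF C] by blast
  show "support C \<subseteq> X"
    using module_subset[OF mod] unfolding support_def by blast
  fix w m m' assume w: "w \<in> X - support C" and m: "m \<in> support C" and m': "m' \<in> support C"
  obtain A B where A: "A \<in> C" "m \<in> A" and B: "B \<in> C" "m' \<in> B"
    using m m' unfolding support_def by blast
  have rel: "(w, d, e) \<in> H" if "D \<in> C" "d \<in> D" "e \<in> D" for D d e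
    using mod[OF that(1)] that w unfolding homogeneous_module_def support_def by blast
  have tr: "trans {(y, z). (w, y, z) \<in> H}"
    using H w by (auto simp: homogeneous_relation_def equiv_def)
  from C A(1) B(1) have "\<forall>e\<in>B. (w, m, e) \<in> H"
  proof (induction rule: overlap_class_induct)
    case base
    show ?case using rel[OF A] by blast
  next
    case (step D E)
    then obtain d where d: "d \<in> D" "d \<in> E" unfolding overlaps_def by blast
    show ?case
    proof
      fix e assume "e \<in> E"
      then have "(w, d, e) \<in> H" using rel step d by blast
      moreover have "(w, m, d) \<in> H" using step d by blast
      ultimately show "(w, m, e) \<in> H" using tr by (auto dest: transD)
    qed
  qed
  with B(2) show "(w, m, m') \<in> H" by blast
qed

lemma support_strong_module:
  assumes H: "homogeneous_relation X H" and C: "C \<in> overlap_classes (Z_family X H)"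
  shows "strong_module X H (support C)"
  unfolding strong_module_def
proof (intro conjI allI impI notI)
  show "homogeneous_module X H (support C)"
    using support_homogeneous_module[OF H C] Z_family_module[OF H] by blast
  fix N assume N: "homogeneous_module X H N" and ov: "overlaps (support C) N"
  obtain n where n: "n \<in> N" "n \<notin> support C"
    using ov unfolding overlaps_def by blast
  obtain x y A0 B0 where 0: "A0 \<in> C" "x \<in> A0" "x \<in> N" "B0 \<in> C" "y \<in> B0" "y \<notin> N"
    using ov unfolding overlaps_def support_def by blast
  \<comment> \<open>Otherwise every member meeting \<open>N\<close> lies inside \<open>N\<close>,
    since \<open>n\<close> rules out that it contains \<open>N\<close>. A chain of overlaps from
    \<open>A0\<close> then never leaves \<open>N\<close>, although \<open>B0\<close> contains
    \<open>y\<close>.\<close>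
  have "\<exists>A\<in>C. overlaps A N"
  proof (rule ccontr)
    assume none: "\<not> (\<exists>A\<in>C. overlaps A N)"
    have sub: "D \<subseteq> N" if "D \<in> C" "D \<inter> N \<noteq> {}" for D
    proof -
      have "n \<notin> D" using n that unfolding support_def by blast
      with none that n show ?thesis unfolding overlaps_def by blast
    qed
    from C 0(1,4) have "B0 \<subseteq> N"
    proof (induction rule: overlap_class_induct)
      case base
      show ?case using sub 0 by blast
    next
      case (step D E)
      then show ?case using sub unfolding overlaps_def by blast
    qed
    with 0 show False by blast
  qed
  then obtain A where A: "A \<in> C" "overlaps A N" by blast
  then obtain x y where xy: "x \<in> A" "x \<in> N" "y \<in> A" "y \<notin> N"
    unfolding overlaps_def by blast
  have nZ: "n \<in> Z X H x y" and xZ: "x \<in> Z X H x y"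
    using module_subset_Z[OF N xy(2,4)] n xy by auto
  have "n \<notin> A" using n A unfolding support_def by blast
  \<comment> \<open>The point \<open>x\<close> is shared, \<open>y\<close> lies only in
    \<open>A\<close>, and \<open>n\<close> only in \<open>Z X H x y\<close>.\<close>
  with xy nZ xZ have "overlaps A (Z X H x y)"
    using not_in_Z[of y X H x] unfolding overlaps_def by blast
  moreover have "A \<subseteq> X"
    using A overlap_class_subset[OF C] Z_family_module[OF H] module_subset by blast
  then have "Z X H x y \<in> Z_family X H"
    using xy by (auto intro!: Z_in_Z_family)
  ultimately have "Z X H x y \<in> C" using overlap_class_closed[OF C A(1)] by blast
  with nZ n show False unfolding support_def by blast
qed

section \<open>Atoms\<close>

text \<open>If \<open>N\<close> overlaps \<open>T\<close>, then \<open>?Z\<close> splits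
  \<open>T\<close>, so it is outside the class and overlaps no member. Maximality of
  \<open>T\<close> supplies a member inside \<open>?Z\<close>, and chains of overlaps then confine
  the whole class to \<open>?Z\<close>, although \<open>y\<close> is in the support.\<close>

lemma atom_not_overlaps_module:
  assumes H: "homogeneous_relation X H" and C: "C \<in> overlap_classes (Z_family X H)"
    and T: "atom C T" and N: "homogeneous_module X H N"
  shows "\<not> overlaps T N"
proof
  assume ov: "overlaps T N"
  then obtain x y n where xyn: "x \<in> T" "x \<in> N" "y \<in> T" "y \<notin> N" "n \<in> N" "n \<notin> T"
    unfolding overlaps_def by blast
  let ?Z = "Z X H x y"
  have u: "unsplit C T" using T unfolding atom_def by blast
  then obtain A where A: "A \<in> C" "T \<subseteq> A" unfolding unsplit_def by blast
  have Ts: "T \<subseteq> support C" using u unfolding unsplit_def by blast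
  have strong: "strong_module X H (support C)" by (rule support_strong_module[OF H C])
  have "\<not> overlaps (support C) N"
    using strong N unfolding strong_module_def by blast
  then have nS: "n \<in> support C"
    using Ts xyn unfolding overlaps_def by blast
  have NZ: "N \<subseteq> ?Z" using module_subset_Z[OF N xyn(2,4)] .
  have yZ: "y \<notin> ?Z" by (rule not_in_Z)
  have "support C \<subseteq> X" using strong unfolding strong_module_def by (blast dest: module_subset)
  then have ZF: "?Z \<in> Z_family X H" using Ts xyn by (auto intro!: Z_in_Z_family)
  have "overlaps T ?Z" using xyn NZ yZ unfolding overlaps_def by blast
  then have "?Z \<notin> C" using u unfolding unsplit_def by blast
  then have none: "\<not> overlaps D ?Z" if "D \<in> C" for D
    using that overlap_class_closed[OF C _ ZF] by blast
  \<comment> \<open>Such a \<open>D\<close> shares \<open>x\<close> with \<open>?Z\<close> and has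
    \<open>y\<close> outside it; not overlapping \<open>?Z\<close>, it must contain
    \<open>?Z\<close>.\<close>
  have super: "n \<in> D" if "D \<in> C" "T \<subseteq> D" for D
    using none[OF that(1)] that xyn NZ yZ unfolding overlaps_def by blast
  \<comment> \<open>If every member containing \<open>n\<close> contained \<open>T\<close>, no
    member would separate \<open>n\<close> from \<open>T\<close>, and \<open>insert n T\<close>
    would be a larger unsplit set.\<close>
  have "\<exists>D\<in>C. n \<in> D \<and> \<not> T \<subseteq> D"
  proof (rule ccontr)
    assume "\<not> ?thesis"
    then have all: "T \<subseteq> D" if "D \<in> C" "n \<in> D" for D using that by blast
    have "unsplit C (insert n T)"
      unfolding unsplit_def
    proof (intro conjI ballI)
      show "insert n T \<subseteq> support C" using Ts nS by blast
      show "\<exists>A\<in>C. insert n T \<subseteq> A" using A super[OF A] by blast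
      fix D assume D: "D \<in> C"
      then have "\<not> overlaps T D" using u unfolding unsplit_def by blast
      with all[OF D] super[OF D] xyn(1) show "\<not> overlaps (insert n T) D"
        unfolding overlaps_def by blast
    qed
    then show False using T xyn unfolding atom_def by blast
  qed
  then obtain D where D: "D \<in> C" "n \<in> D" "\<not> T \<subseteq> D" by blast
  have "x \<notin> D"
    using unsplit_same_members[OF C u xyn(1) _ D(1)] D(3) by blast
  then have "D \<subseteq> ?Z"
    using none[OF D(1)] D xyn NZ unfolding overlaps_def by blast
  with C D(1) A(1) have "A \<subseteq> ?Z"
  proof (induction rule: overlap_class_induct)
    case base
    then show ?case .
  next
    case (step E E')
    \<comment> \<open>The set \<open>E'\<close> meets \<open>?Z\<close>. The alternative that it
      contains \<open>?Z\<close> would give \<open>E\<close> \<subseteq> \<open>E'\<close>, but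
      these two overlap.\<close>
    then show ?case using none[of E'] unfolding overlaps_def by blast
  qed
  with A xyn yZ show False by blast
qed

section \<open>Strong modules as supports or atoms\<close>

lemma nonoverlapped_is_support:
  assumes M: "M \<in> F" and no: "\<And>A. A \<in> F \<Longrightarrow> \<not> overlaps M A"
  obtains C where "C \<in> overlap_classes F" "M = support C"
proof -
  obtain C where C: "C \<in> overlap_classes F" "M \<in> C" using in_overlap_class[OF M] .
  have "B = M" if "B \<in> C" for B
    using C that
  proof (induction rule: overlap_class_induct)
    case base
    show ?case ..
  next
    case (step D E)
    then show ?case using no overlap_class_subset[OF C(1)] by blast
  qed
  with C have "M = support C" unfolding support_def by blast
  with C that show thesis by blast
qed

lemma strong_module_is_support_or_atom:
  assumes fin: "finite X" and H: "homogeneous_relation X H"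
    and M: "strong_module X H M" and ne: "M \<noteq> {}" "M \<noteq> X"
  shows "\<exists>C\<in>overlap_classes (Z_family X H). M = support C \<or> atom C M"
proof (cases "M \<in> Z_family X H")
  case True
  moreover have "\<not> overlaps M A" if "A \<in> Z_family X H" for A
    using M Z_family_module[OF H that] unfolding strong_module_def by blast
  ultimately show ?thesis by (blast elim: nonoverlapped_is_support)
next
  case False
  have Mm: "homogeneous_module X H M" using M unfolding strong_module_def by blast
  have MX: "M \<subseteq> X" using module_subset[OF Mm] .
  have larger: "Z X H m p \<in> Z_family X H" "M \<subset> Z X H m p" if "m \<in> M" "p \<in> X" "p \<notin> M" for m p
  proof -
    show ZF: "Z X H m p \<in> Z_family X H" using that MX by (auto intro!: Z_in_Z_family)
    with False module_subset_Z[OF Mm that(1,3)] show "M \<subset> Z X H m p" by blast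
  qed
  let ?L = "{P \<in> Z_family X H. M \<subset> P}"
  have "Z_family X H \<subseteq> Pow X" using Z_family_module[OF H] module_subset by blast
  then have finL: "finite ?L" using fin by (auto intro: finite_subset)
  obtain m y where my: "m \<in> M" "y \<in> X" "y \<notin> M" using ne MX by blast
  then have "?L \<noteq> {}" using larger by blast
  then obtain P where P: "P \<in> ?L" and Pmin: "\<And>Q. Q \<in> ?L \<Longrightarrow> Q \<subseteq> P \<Longrightarrow> Q = P"
    using finite_has_minimal[OF finL] by metis
  have PX: "P \<subseteq> X" using P Z_family_module[OF H] module_subset by blast
  obtain C where C: "C \<in> overlap_classes (Z_family X H)" "P \<in> C"
    using in_overlap_class P by blast
  have cut: "Z X H m p \<in> C" if p: "p \<in> P" "p \<notin> M" for p
  proof -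
    have Q: "Z X H m p \<in> ?L" using larger[OF my(1) _ p(2)] p PX by blast
    have "p \<notin> Z X H m p" by (rule not_in_Z)
    \<comment> \<open>Both sets contain \<open>m\<close>. By minimality of \<open>P\<close>,
      inclusion of \<open>Z X H m p\<close> in \<open>P\<close> would force equality, but only
      \<open>P\<close> contains \<open>p\<close>.\<close>
    then have "overlaps P (Z X H m p)"
      using Pmin[OF Q] p Q P my unfolding overlaps_def by blast
    then show ?thesis using overlap_class_closed[OF C] Q by blast
  qed
  have "unsplit C M"
    unfolding unsplit_def
  proof (intro conjI ballI)
    show "M \<subseteq> support C" "\<exists>A\<in>C. M \<subseteq> A" using C P unfolding support_def by blast+
    fix A assume "A \<in> C"
    then have "homogeneous_module X H A"
      using overlap_class_subset[OF C(1)] Z_family_module[OF H] by blast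
    then show "\<not> overlaps M A" using M unfolding strong_module_def by blast
  qed
  moreover have "T \<subseteq> M" if T: "unsplit C T" "M \<subseteq> T" for T
  proof
    fix t assume t: "t \<in> T"
    have same: "t \<in> A" if "A \<in> C" "m \<in> A" for A
      using unsplit_same_members[OF C(1) T(1) _ t that] T(2) my(1) by blast
    \<comment> \<open>No member separates \<open>t\<close> from \<open>m\<close>, so
      \<open>t\<close> lies in \<open>P\<close>. Were \<open>t\<close> outside \<open>M\<close>,
      then \<open>Z X H m t\<close> would be a member that does separate them.\<close>
    show "t \<in> M"
    proof (rule ccontr)
      assume "t \<notin> M"
      moreover have "t \<in> P" using same[OF C(2)] P my(1) by blast
      ultimately have "Z X H m t \<in> C" "m \<in> Z X H m t"
        using cut larger(2)[OF my(1)] PX my(1) by blast+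
      then show False using same not_in_Z[of t X H m] by blast
    qed
  qed
  ultimately have "atom C M" unfolding atom_def by blast
  with C show ?thesis by blast
qed

theorem theorem2:
  fixes X :: "'a set" and H :: "('a \<times> 'a \<times> 'a) set"
  assumes "finite X"
    and "homogeneous_relation X H"
  shows "(\<forall>C\<in>overlap_classes (Z_family X H).
            strong_module X H (support C) \<and>
            (\<forall>T. atom C T \<and> homogeneous_module X H T \<longrightarrow> strong_module X H T)) \<and>
         (\<forall>M. strong_module X H M \<and> \<not> trivial_module X M \<longrightarrow>
            (\<exists>C\<in>overlap_classes (Z_family X H). M = support C \<or> atom C M))"
proof (intro conjI ballI allI impI)
  fix C assume C: "C \<in> overlap_classes (Z_family X H)"
  show "strong_module X H (support C)" by (rule support_strong_module[OF assms(2) C])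
  fix T assume "atom C T \<and> homogeneous_module X H T"
  then show "strong_module X H T"
    using atom_not_overlaps_module[OF assms(2) C] unfolding strong_module_def by blast
next
  fix M assume M: "strong_module X H M \<and> \<not> trivial_module X M"
  then have "M \<noteq> {}" "M \<noteq> X" unfolding trivial_module_def by auto
  with M show "\<exists>C\<in>overlap_classes (Z_family X H). M = support C \<or> atom C M"
    using strong_module_is_support_or_atom[OF assms] by blast
qed

end
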